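(* Let $\mathcal{X}$ be a commutative association scheme with thin radical $G$ of order $r$. Suppose that (1) for suitable orderings of its relations and primitive idempotents, the first eigenmatrix of $\mathcal{X}$ has the block form \[ \mathsf{P}=\begin{bmatrix}\mathbb{T}&\mathsf{D}_+\mathbb{T}\\ \mathbb{T}&\mathsf{D}_-\mathbb{T}\end{bmatrix}, \] where $\mathsf{D}_+,\mathsf{D}_-$ are diagonal matrices and $\mathbb{T}$ is the character table of $G$ (rows indexed by the characters of $G$, columns by the elements of $G$), the first $r$ columns of $\mathsf{P}$ corresponding to the thin relations, the column of $\mathbb{T}$ indexed by $g\in G$ corresponding to the thin relation $g$; and (2) at least one column of $\mathsf{P}$ corresponding to a thick relation has all entries real. Then $\mathcal{X}$ is (isomorphic to) a roux scheme.
   Context: Association schemes are commutative: a partition of $\Omega\times\Omega$ into relations including the identity, closed under transpose, with intersection numbers $p_{ij}^k$ satisfying $p_{ij}^k=p_{ji}^k$. A relation is thin if its valency is $1$ (its adjacency matrix is a permutation matrix) and thick otherwise; the thin relations form a group under product of adjacency matrices, the thin radical. The first eigenmatrix $\mathsf{P}$ is defined by $\mathsf{A}_j=\sum_i\mathsf{P}_{ij}\mathsf{E}_i$, where $\mathsf{A}_j$ are the adjacency matrices and $\mathsf{E}_i$ the primitive idempotents. A roux matrix for an abelian group $G$ is a square matrix $\mathsf{B}$ over $\mathbb{C}[G]$ with zero diagonal, off-diagonal entries in $G$, $\mathsf{B}_{ji}=\mathsf{B}_{ij}^{-1}$ for $i\neq j$, and such that $\{g\mathsf{I}\}_{g\in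 G}\cup\{g\mathsf{B}\}_{g\in G}$ span an algebra; applying the regular permutation representation of $G$ entrywise to $g\mathsf{I}$ and $g\mathsf{B}$ ($g\in G$) gives the adjacency matrices of an association scheme, called a roux scheme. *)

theory Defs
  imports "HOL-Analysis.Analysis" "HOL-Algebra.Coset" "HOL-Library.Disjoint_Sets"
begin

section \<open>Commutative association schemes\<close>

definition comm_association_scheme :: "'a set \<Rightarrow> ('a \<times> 'a) set set \<Rightarrow> bool" where
  "comm_association_scheme \<Omega> Rs \<longleftrightarrow>
     finite \<Omega> \<and> partition_on (\<Omega> \<times> \<Omega>) Rs \<and> Id_on \<Omega> \<in> Rs \<and> (\<forall>R\<in>Rs. R\<inverse> \<in> Rs) \<and>
     (\<exists>p. (\<forall>R\<in>Rs. \<forall>S\<in>Rs. \<forall>T\<in>Rs. \<forall>(x, y)\<in>T. card {z\<in>\<Omega>. (x, z) \<in> R \<and> (z, y) \<in> S} = p R S T) \<and>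
          (\<forall>R\<in>Rs. \<forall>S\<in>Rs. \<forall>T\<in>Rs. p R S T = (p S R T :: nat)))"

definition has_valency :: "'a set \<Rightarrow> ('a \<times> 'a) set \<Rightarrow> nat \<Rightarrow> bool" where
  "has_valency \<Omega> R k \<longleftrightarrow> (\<forall>x\<in>\<Omega>. card {y\<in>\<Omega>. (x, y) \<in> R} = k)"

definition thin :: "'a set \<Rightarrow> ('a \<times> 'a) set \<Rightarrow> bool" where
  "thin \<Omega> R \<longleftrightarrow> has_valency \<Omega> R 1"

definition scheme_isomorphic ::
    "'a set \<Rightarrow> ('a \<times> 'a) set set \<Rightarrow> 'b set \<Rightarrow> ('b \<times> 'b) set set \<Rightarrow> bool" where
  "scheme_isomorphic \<Omega> Rs \<Omega>' Rs' \<longleftrightarrow>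
     (\<exists>f. bij_betw f \<Omega> \<Omega>' \<and> (\<lambda>R. map_prod f f ` R) ` Rs = Rs')"

section \<open>Adjacency algebra and first eigenmatrix, for schemes on a finite type\<close>

definition adj_mat :: "('a::finite \<times> 'a) set \<Rightarrow> complex^'a^'a" where
  "adj_mat R = (\<chi> x y. of_bool ((x, y) \<in> R))"

definition mat_scale :: "complex \<Rightarrow> complex^'a^'a \<Rightarrow> complex^'a^'a" where
  "mat_scale c M = (\<chi> x y. c * M $ x $ y)"

definition adjacency_algebra :: "('a::finite \<times> 'a) set set \<Rightarrow> (complex^'a^'a) set" where
  "adjacency_algebra Rs = {M. \<exists>c. M = (\<Sum>R\<in>Rs. mat_scale (c R) (adj_mat R))}"

definition primitive_idempotents :: "(complex^'a^'a) set \<Rightarrow> (complex^('a::finite)^'a) set" where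
  "primitive_idempotents \<A> = {E\<in>\<A>. E \<noteq> 0 \<and> E ** E = E \<and>
     \<not> (\<exists>F\<in>\<A>. \<exists>F'\<in>\<A>. F \<noteq> 0 \<and> F' \<noteq> 0 \<and> F ** F = F \<and> F' ** F' = F' \<and>
          F ** F' = 0 \<and> F' ** F = 0 \<and> E = F + F')}"

text \<open>
  The \<open>m \<times> m\<close> matrix \<open>P\<close> is the first eigenmatrix with respect to the enumerations
  \<open>R\<close> of the relations and \<open>E\<close> of the primitive idempotents by \<open>{..<m}\<close>; only the entries of
  \<open>P\<close> with indices below \<open>m\<close> matter.
\<close>
definition first_eigenmatrix ::
    "('a::finite \<times> 'a) set set \<Rightarrow> nat \<Rightarrow> (nat \<Rightarrow> ('a \<times> 'a) set) \<Rightarrow> (nat \<Rightarrow> complex^'a^'a) \<Rightarrow>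
     (nat \<Rightarrow> nat \<Rightarrow> complex) \<Rightarrow> bool" where
  "first_eigenmatrix Rs m R E P \<longleftrightarrow>
     bij_betw R {..<m} Rs \<and>
     bij_betw E {..<m} (primitive_idempotents (adjacency_algebra Rs)) \<and>
     (\<forall>j<m. adj_mat (R j) = (\<Sum>i<m. mat_scale (P i j) (E i)))"

text \<open>The elements of the thin radical are the adjacency matrices of the thin relations.\<close>
definition thin_radical :: "('a::finite \<times> 'a) set set \<Rightarrow> (complex^'a^'a) monoid" where
  "thin_radical Rs =
     \<lparr>carrier = adj_mat ` {R\<in>Rs. thin UNIV R}, mult = (**), one = mat 1\<rparr>"

section \<open>Characters\<close>

definition complex_units :: "complex monoid" where
  "complex_units = \<lparr>carrier = - {0}, mult = (*), one = 1\<rparr>"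

text \<open>
  For finite \<open>G\<close>, homomorphisms to the nonzero complex numbers. Extensionality makes a character
  of \<open>G\<close> a single HOL function, so that the characters can be enumerated without repetition.
\<close>
definition characters :: "('g, 'm) monoid_scheme \<Rightarrow> ('g \<Rightarrow> complex) set" where
  "characters G = hom G complex_units \<inter> extensional (carrier G)"

section \<open>Roux matrices over a finite abelian group\<close>

text \<open>
  An element of the complex group algebra of a finite group \<open>G\<close> is its coefficient function,
  which vanishes outside \<open>carrier G\<close>. An \<open>n \<times> n\<close> matrix over the group algebra is a function
  on pairs of indices which is zero unless both indices are below \<open>n\<close>.
\<close>
definition ga_elem :: "'g \<Rightarrow> 'g \<Rightarrow> complex" where
  "ga_elem g = (\<lambda>x. of_bool (x = g))"

definition ga_mult ::
    "('g, 'm) monoid_scheme \<Rightarrow> ('g \<Rightarrow> complex) \<Rightarrow> ('g \<Rightarrow> complex) \<Rightarrow> 'g \<Rightarrow> complex" where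
  "ga_mult G a b =
     (\<lambda>x. \<Sum>g\<in>carrier G. \<Sum>h\<in>carrier G. a g * b h * of_bool (x = g \<otimes>\<^bsub>G\<^esub> h))"

type_synonym 'g ga_mat = "nat \<Rightarrow> nat \<Rightarrow> 'g \<Rightarrow> complex"

definition ga_mat_carrier :: "('g, 'm) monoid_scheme \<Rightarrow> nat \<Rightarrow> 'g ga_mat set" where
  "ga_mat_carrier G n =
     {M. \<forall>i j x. M i j x \<noteq> 0 \<longrightarrow> i < n \<and> j < n \<and> x \<in> carrier G}"

definition ga_mat_id :: "('g, 'm) monoid_scheme \<Rightarrow> nat \<Rightarrow> 'g ga_mat" where
  "ga_mat_id G n = (\<lambda>i j. if i < n \<and> i = j then ga_elem \<one>\<^bsub>G\<^esub> else (\<lambda>_. 0))"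

definition ga_mat_mult ::
    "('g, 'm) monoid_scheme \<Rightarrow> nat \<Rightarrow> 'g ga_mat \<Rightarrow> 'g ga_mat \<Rightarrow> 'g ga_mat" where
  "ga_mat_mult G n M N = (\<lambda>i j x. \<Sum>k<n. ga_mult G (M i k) (N k j) x)"

definition ga_mat_scale :: "('g, 'm) monoid_scheme \<Rightarrow> 'g \<Rightarrow> 'g ga_mat \<Rightarrow> 'g ga_mat" where
  "ga_mat_scale G g M = (\<lambda>i j. ga_mult G (ga_elem g) (M i j))"

definition ga_mat_span :: "'g ga_mat set \<Rightarrow> 'g ga_mat set" where
  "ga_mat_span S = {M. \<exists>c. M = (\<lambda>i j x. \<Sum>N\<in>S. c N * N i j x)}"

definition roux_basis :: "('g, 'm) monoid_scheme \<Rightarrow> nat \<Rightarrow> 'g ga_mat \<Rightarrow> 'g ga_mat set" where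
  "roux_basis G n B =
     (\<lambda>g. ga_mat_scale G g (ga_mat_id G n)) ` carrier G \<union> (\<lambda>g. ga_mat_scale G g B) ` carrier G"

definition roux_matrix :: "('g, 'm) monoid_scheme \<Rightarrow> nat \<Rightarrow> 'g ga_mat \<Rightarrow> bool" where
  "roux_matrix G n B \<longleftrightarrow>
     comm_group G \<and> finite (carrier G) \<and> B \<in> ga_mat_carrier G n \<and>
     (\<forall>i<n. B i i = (\<lambda>_. 0)) \<and>
     (\<forall>i<n. \<forall>j<n. i \<noteq> j \<longrightarrow>
        (\<exists>g\<in>carrier G. B i j = ga_elem g \<and> B j i = ga_elem (inv\<^bsub>G\<^esub> g))) \<and>
     (\<forall>M\<in>ga_mat_span (roux_basis G n B). \<forall>N\<in>ga_mat_span (roux_basis G n B).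
        ga_mat_mult G n M N \<in> ga_mat_span (roux_basis G n B))"

text \<open>
  The regular representation extended linearly to the group algebra, as a matrix with rows and
  columns indexed by \<open>carrier G\<close>: the group element \<open>g\<close> sends the basis vector of \<open>k\<close> to the
  basis vector of \<open>g \<otimes> k\<close>. Applying it entrywise yields a matrix indexed by
  \<open>{..<n} \<times> carrier G\<close>.
\<close>
definition regular_rep ::
    "('g, 'm) monoid_scheme \<Rightarrow> ('g \<Rightarrow> complex) \<Rightarrow> 'g \<Rightarrow> 'g \<Rightarrow> complex" where
  "regular_rep G a h k = (\<Sum>g\<in>carrier G. a g * of_bool (h = g \<otimes>\<^bsub>G\<^esub> k))"

definition regular_lift ::
    "('g, 'm) monoid_scheme \<Rightarrow> 'g ga_mat \<Rightarrow> nat \<times> 'g \<Rightarrow> nat \<times> 'g \<Rightarrow> complex" where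
  "regular_lift G M = (\<lambda>(i, h) (j, k). regular_rep G (M i j) h k)"

definition roux_points :: "('g, 'm) monoid_scheme \<Rightarrow> nat \<Rightarrow> (nat \<times> 'g) set" where
  "roux_points G n = {..<n} \<times> carrier G"

definition roux_relations ::
    "('g, 'm) monoid_scheme \<Rightarrow> nat \<Rightarrow> 'g ga_mat \<Rightarrow> ((nat \<times> 'g) \<times> (nat \<times> 'g)) set set" where
  "roux_relations G n B =
     {R. R \<subseteq> roux_points G n \<times> roux_points G n \<and>
         (\<exists>M\<in>roux_basis G n B. \<forall>x\<in>roux_points G n. \<forall>y\<in>roux_points G n.
            regular_lift G M x y = of_bool ((x, y) \<in> R))}"

text \<open>
  Every finite group is isomorphic to one whose elements are natural numbers, so letting \<open>G\<close>
  range over the groups on subsets of \<open>nat\<close> is no restriction. For \<open>n = 1\<close> one has \<open>B = 0\<close>,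
  which gives an empty relation; no scheme is isomorphic to this family, since the relations
  of a scheme are nonempty.
\<close>
definition is_roux_scheme :: "'a set \<Rightarrow> ('a \<times> 'a) set set \<Rightarrow> bool" where
  "is_roux_scheme \<Omega> Rs \<longleftrightarrow>
     comm_association_scheme \<Omega> Rs \<and>
     (\<exists>(G :: nat monoid) n B. roux_matrix G n B \<and>
        scheme_isomorphic \<Omega> Rs (roux_points G n) (roux_relations G n B))"

end

(*
  The two shapes of the right-hand blocks of P say that, with B the thick relation in the column of
  the identity, every thick adjacency matrix is a thin one times B. Eigenvalues determine the
  matrices because the primitive idempotents are orthogonal; these are moreover Hermitian, so a
  thick relation S with real eigenvalues is symmetric, and the thick relations are exactly the
  translates of S by the thin radical G. Now G acts freely on the points. Choose
  representatives w i of its orbits. Two points in distinct orbits are related by exactly one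
  translate of S, so the block of S at two distinct orbits is the permutation matrix of a single
  element of G; blocks at (i, j) and (j, i) are inverse because S is symmetric. Closure of
  the span is inherited from the adjacency algebra, on which taking coefficients along the orbits
  is multiplicative.
*)

theory Submission
  imports Defs
begin

section \<open>The adjacency algebra\<close>

locale comm_scheme =
  fixes Rs :: "('a::finite \<times> 'a) set set"
  assumes scheme: "comm_association_scheme (UNIV :: 'a set) Rs"
begin

lemma partition: "partition_on UNIV Rs"
  using scheme by (simp add: comm_association_scheme_def)

lemma Id_in: "Id \<in> Rs"
proof -
  have "Id_on UNIV = (Id :: ('a \<times> 'a) set)" by auto
  then show ?thesis using scheme by (simp add: comm_association_scheme_def)
qed

lemma converse_in: "S \<in> Rs \<Longrightarrow> S\<inverse> \<in> Rs"
  using scheme by (simp add: comm_association_scheme_def)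

lemma obtain_rel: obtains S where "S \<in> Rs" "(x, y) \<in> S"
  using partition_onD1[OF partition] by blast

lemma rel_eqI: "S \<in> Rs \<Longrightarrow> S' \<in> Rs \<Longrightarrow> p \<in> S \<Longrightarrow> p \<in> S' \<Longrightarrow> S = S'"
  using partition_onD2[OF partition] by (auto simp: disjoint_def)

lemma nonempty: "S \<in> Rs \<Longrightarrow> S \<noteq> {}"
  using partition_onD3[OF partition] by blast

lemma card_paths_eq:
  assumes "S \<in> Rs" "S' \<in> Rs" "T \<in> Rs" "(x, y) \<in> T" "(x', y') \<in> T"
  shows "card {z. (x, z) \<in> S \<and> (z, y) \<in> S'} = card {z. (x', z) \<in> S \<and> (z, y') \<in> S'}"
proof -
  obtain p where p: "\<forall>R\<in>Rs. \<forall>S\<in>Rs. \<forall>T\<in>Rs. \<forall>(x, y)\<in>T.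
      card {z\<in>UNIV. (x, z) \<in> R \<and> (z, y) \<in> S} = p R S T"
    using scheme unfolding comm_association_scheme_def by blast
  show ?thesis
    using bspec[OF bspec[OF bspec[OF bspec[OF p assms(1)] assms(2)] assms(3)] assms(4)]
      bspec[OF bspec[OF bspec[OF bspec[OF p assms(1)] assms(2)] assms(3)] assms(5)]
    by simp
qed

lemma card_paths_commute:
  assumes "S \<in> Rs" "S' \<in> Rs"
  shows "card {z. (x, z) \<in> S \<and> (z, y) \<in> S'} = card {z. (x, z) \<in> S' \<and> (z, y) \<in> S}"
proof -
  obtain p where p: "\<forall>R\<in>Rs. \<forall>S\<in>Rs. \<forall>T\<in>Rs. \<forall>(x, y)\<in>T.
      card {z\<in>UNIV. (x, z) \<in> R \<and> (z, y) \<in> S} = p R S T"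
    and comm: "\<forall>R\<in>Rs. \<forall>S\<in>Rs. \<forall>T\<in>Rs. p R S T = (p S R T :: nat)"
    using scheme unfolding comm_association_scheme_def by blast
  obtain T where T: "T \<in> Rs" "(x, y) \<in> T" by (rule obtain_rel)
  show ?thesis
    using bspec[OF bspec[OF bspec[OF bspec[OF p assms(1)] assms(2)] T(1)] T(2)]
      bspec[OF bspec[OF bspec[OF bspec[OF p assms(2)] assms(1)] T(1)] T(2)] comm assms T
    by simp
qed

abbreviation algebra :: "(complex^'a^'a) set" where
  "algebra \<equiv> adjacency_algebra Rs"

lemma sum_adj_mat_nth:
  assumes "S \<in> Rs" "(x, y) \<in> S"
  shows "(\<Sum>S\<in>Rs. mat_scale (c S) (adj_mat S)) $ x $ y = c S"
proof -
  have "(\<Sum>S\<in>Rs. mat_scale (c S) (adj_mat S)) $ x $ y = (\<Sum>T\<in>Rs. c T * of_bool ((x, y) \<in> T))"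
    by (simp add: mat_scale_def adj_mat_def)
  also have "\<dots> = (\<Sum>T\<in>Rs. if T = S then c S else 0)"
  proof (rule sum.cong[OF refl])
    fix T assume "T \<in> Rs"
    then have "(x, y) \<in> T \<longleftrightarrow> T = S" using assms rel_eqI by blast
    then show "c T * of_bool ((x, y) \<in> T) = (if T = S then c S else 0)" by simp
  qed
  finally show ?thesis using assms by simp
qed

text \<open>The relations partition all pairs, so a combination of adjacency matrices has exactly
  one coefficient at each entry. Closure properties of \<open>algebra\<close> thereby become
  statements about single entries.\<close>

lemma in_algebra_iff:
  "M \<in> algebra \<longleftrightarrow>
     (\<forall>S\<in>Rs. \<forall>x y x' y'. (x, y) \<in> S \<longrightarrow> (x', y') \<in> S \<longrightarrow> M $ x $ y = M $ x' $ y')"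
proof
  assume "M \<in> algebra"
  then obtain c where M: "M = (\<Sum>S\<in>Rs. mat_scale (c S) (adj_mat S))"
    unfolding adjacency_algebra_def by blast
  have "M $ x $ y = c S" if "S \<in> Rs" "(x, y) \<in> S" for S x y
    unfolding M using that by (rule sum_adj_mat_nth)
  then show "\<forall>S\<in>Rs. \<forall>x y x' y'. (x, y) \<in> S \<longrightarrow> (x', y') \<in> S \<longrightarrow> M $ x $ y = M $ x' $ y'"
    by metis
next
  assume const:
    "\<forall>S\<in>Rs. \<forall>x y x' y'. (x, y) \<in> S \<longrightarrow> (x', y') \<in> S \<longrightarrow> M $ x $ y = M $ x' $ y'"
  \<comment> \<open>The coefficient of \<open>S\<close> is read off at an arbitrarily chosen pair of
    \<open>S\<close>; constancy makes the choice immaterial.\<close>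
  define c where "c S = (let (x, y) = SOME p. p \<in> S in M $ x $ y)" for S
  have c: "c S = M $ x $ y" if "S \<in> Rs" "(x, y) \<in> S" for S x y
  proof -
    obtain x' y' where xy: "(SOME p. p \<in> S) = (x', y')" by (cases "SOME p. p \<in> S")
    then have "(x', y') \<in> S" using that someI[of "\<lambda>p. p \<in> S" "(x, y)"] by simp
    then have "M $ x' $ y' = M $ x $ y" using const that by blast
    then show ?thesis by (simp add: c_def xy)
  qed
  have "M = (\<Sum>S\<in>Rs. mat_scale (c S) (adj_mat S))"
  proof (intro vec_eq_iff[THEN iffD2] allI)
    fix x y
    obtain S where "S \<in> Rs" "(x, y) \<in> S" by (rule obtain_rel)
    then show "M $ x $ y = (\<Sum>S\<in>Rs. mat_scale (c S) (adj_mat S)) $ x $ y"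
      using sum_adj_mat_nth[of S x y c] c[of S x y] by simp
  qed
  then show "M \<in> algebra" unfolding adjacency_algebra_def by blast
qed

lemma algebra_nth_eq:
  "M \<in> algebra \<Longrightarrow> S \<in> Rs \<Longrightarrow> (x, y) \<in> S \<Longrightarrow> (x', y') \<in> S \<Longrightarrow> M $ x $ y = M $ x' $ y'"
  unfolding in_algebra_iff by blast

lemma adj_mat_in: "S \<in> Rs \<Longrightarrow> adj_mat S \<in> algebra"
  unfolding in_algebra_iff adj_mat_def vec_lambda_beta
  by (intro ballI allI impI arg_cong[where f = of_bool]) (blast dest: rel_eqI)

lemma diff_in: "M \<in> algebra \<Longrightarrow> N \<in> algebra \<Longrightarrow> M - N \<in> algebra"
  unfolding in_algebra_iff[of "M - N"] vector_minus_component
  by (intro ballI allI impI arg_cong2[where f = minus]) (rule algebra_nth_eq; assumption)+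

text \<open>The pair \<open>(x, y)\<close> enters only through numbers of paths, that is,
  intersection numbers. Closure and commutativity of the algebra are both read off from
  this.\<close>

lemma mult_nth:
  assumes "M = (\<Sum>S\<in>Rs. mat_scale (c S) (adj_mat S))" "N = (\<Sum>S\<in>Rs. mat_scale (d S) (adj_mat S))"
  shows "(M ** N) $ x $ y =
    (\<Sum>S\<in>Rs. \<Sum>S'\<in>Rs. c S * d S' * of_nat (card {z. (x, z) \<in> S \<and> (z, y) \<in> S'}))"
proof -
  have "(M ** N) $ x $ y =
      (\<Sum>z\<in>UNIV. (\<Sum>S\<in>Rs. c S * of_bool ((x, z) \<in> S)) * (\<Sum>S'\<in>Rs. d S' * of_bool ((z, y) \<in> S')))"
    by (simp add: assms matrix_matrix_mult_def mat_scale_def adj_mat_def)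
  also have "\<dots> = (\<Sum>z\<in>UNIV. \<Sum>S\<in>Rs. \<Sum>S'\<in>Rs. c S * d S' * of_bool ((x, z) \<in> S \<and> (z, y) \<in> S'))"
    unfolding sum_product of_bool_conj by (simp only: mult_ac)
  also have "\<dots> = (\<Sum>S\<in>Rs. \<Sum>S'\<in>Rs. \<Sum>z\<in>UNIV. c S * d S' * of_bool ((x, z) \<in> S \<and> (z, y) \<in> S'))"
    by (subst sum.swap, rule sum.cong[OF refl], rule sum.swap)
  also have "\<dots> = (\<Sum>S\<in>Rs. \<Sum>S'\<in>Rs. c S * d S' * of_nat (card {z. (x, z) \<in> S \<and> (z, y) \<in> S'}))"
    by (simp add: sum_distrib_left[symmetric] sum_of_bool_eq)
  finally show ?thesis .
qed

lemma mult_in: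
  assumes "M \<in> algebra" "N \<in> algebra"
  shows "M ** N \<in> algebra"
proof -
  obtain c d where "M = (\<Sum>S\<in>Rs. mat_scale (c S) (adj_mat S))"
      "N = (\<Sum>S\<in>Rs. mat_scale (d S) (adj_mat S))"
    using assms unfolding adjacency_algebra_def by blast
  note nth = mult_nth[OF this]
  show ?thesis
    unfolding in_algebra_iff nth
    by (intro ballI allI impI sum.cong refl arg_cong2[where f = "(*)"] arg_cong[where f = of_nat])
      (rule card_paths_eq)
qed

lemma mult_commute:
  assumes "M \<in> algebra" "N \<in> algebra"
  shows "M ** N = N ** M"
proof -
  obtain c d where M: "M = (\<Sum>S\<in>Rs. mat_scale (c S) (adj_mat S))"
    and N: "N = (\<Sum>S\<in>Rs. mat_scale (d S) (adj_mat S))"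
    using assms unfolding adjacency_algebra_def by blast
  have "(M ** N) $ x $ y = (N ** M) $ x $ y" for x y
    unfolding mult_nth[OF M N] mult_nth[OF N M]
    by (subst sum.swap, intro sum.cong refl arg_cong2[where f = "(*)", OF mult.commute]
          arg_cong[where f = of_nat] card_paths_commute)
  then show ?thesis by (simp add: vec_eq_iff)
qed

end

section \<open>Conjugate transposes and orthogonal idempotents\<close>

definition adjoint_mat :: "complex^'n^'m \<Rightarrow> complex^'m^'n" where
  "adjoint_mat M = (\<chi> i j. cnj (M $ j $ i))"

lemma adjoint_mat_adjoint_mat [simp]: "adjoint_mat (adjoint_mat M) = M"
  by (simp add: adjoint_mat_def vec_eq_iff)

lemma adjoint_mat_0 [simp]: "adjoint_mat 0 = 0"
  by (simp add: adjoint_mat_def vec_eq_iff)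

lemma adjoint_mat_eq_0_iff [simp]: "adjoint_mat M = 0 \<longleftrightarrow> M = 0"
  by (metis adjoint_mat_0 adjoint_mat_adjoint_mat)

lemma adjoint_mat_add: "adjoint_mat (M + N) = adjoint_mat M + adjoint_mat N"
  by (simp add: adjoint_mat_def vec_eq_iff)

lemma adjoint_mat_sum: "adjoint_mat (\<Sum>i\<in>I. f i) = (\<Sum>i\<in>I. adjoint_mat (f i))"
  by (induction I rule: infinite_finite_induct) (simp_all add: adjoint_mat_add)

lemma adjoint_mat_scale: "adjoint_mat (mat_scale c M) = mat_scale (cnj c) (adjoint_mat M)"
  by (simp add: adjoint_mat_def mat_scale_def vec_eq_iff)

lemma adjoint_mat_mult: "adjoint_mat (M ** N) = adjoint_mat N ** adjoint_mat M"
  by (simp add: adjoint_mat_def matrix_matrix_mult_def vec_eq_iff mult.commute)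

lemma adjoint_mat_adj_mat: "adjoint_mat (adj_mat S) = adj_mat (S\<inverse>)"
  by (simp add: adjoint_mat_def adj_mat_def vec_eq_iff)

text \<open>Each diagonal entry of the product is the squared norm of a row of
  \<open>M\<close>.\<close>

lemma mult_adjoint_mat_eq_0:
  assumes "M ** adjoint_mat M = 0"
  shows "M = 0"
proof -
  have "M $ i $ j = 0" for i j
  proof -
    have "0 = (M ** adjoint_mat M) $ i $ i" using assms by simp
    also have "\<dots> = (\<Sum>k\<in>UNIV. of_real ((cmod (M $ i $ k))\<^sup>2))"
      by (simp add: matrix_matrix_mult_def adjoint_mat_def complex_norm_square[symmetric])
    finally have "(\<Sum>k\<in>UNIV. (cmod (M $ i $ k))\<^sup>2) = 0"
      by (metis of_real_sum of_real_eq_0_iff)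
    then show ?thesis by (simp add: sum_nonneg_eq_0_iff)
  qed
  then show ?thesis by (simp add: vec_eq_iff)
qed

lemma mat_scale_mult: "mat_scale a M ** mat_scale b N = mat_scale (a * b) (M ** N)"
  by (simp add: mat_scale_def matrix_matrix_mult_def vec_eq_iff sum_distrib_left mult_ac)

lemma mat_scale_0 [simp]: "mat_scale c 0 = 0" "mat_scale 0 M = 0"
  by (simp_all add: mat_scale_def vec_eq_iff)

lemma sum_matrix_mult: "(\<Sum>i\<in>I. f i) ** N = (\<Sum>i\<in>I. f i ** (N :: complex^'n^'m))"
  by (induction I rule: infinite_finite_induct) 
    (simp_all add: matrix_matrix_mult_def vec_eq_iff ring_distribs sum.distrib)

lemma matrix_mult_sum: "N ** (\<Sum>i\<in>I. f i) = (\<Sum>i\<in>I. (N :: complex^'n^'m) ** f i)"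
  by (induction I rule: infinite_finite_induct) (simp_all add: matrix_add_ldistrib)

text \<open>All cross terms vanish, so eigenvalues multiply coordinatewise.\<close>

lemma orthogonal_idempotents_mult:
  fixes e :: "'i \<Rightarrow> complex^'n^'n"
  assumes "finite I"
    and "\<And>i. i \<in> I \<Longrightarrow> e i ** e i = e i"
    and "\<And>i j. i \<in> I \<Longrightarrow> j \<in> I \<Longrightarrow> i \<noteq> j \<Longrightarrow> e i ** e j = 0"
  shows "(\<Sum>i\<in>I. mat_scale (a i) (e i)) ** (\<Sum>i\<in>I. mat_scale (b i) (e i)) =
    (\<Sum>i\<in>I. mat_scale (a i * b i) (e i))"
proof -
  have "(\<Sum>i\<in>I. mat_scale (a i) (e i)) ** (\<Sum>i\<in>I. mat_scale (b i) (e i)) =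
      (\<Sum>i\<in>I. \<Sum>j\<in>I. if j = i then mat_scale (a i * b i) (e i) else 0)"
    unfolding sum_matrix_mult matrix_mult_sum mat_scale_mult
    by (intro sum.cong refl) (use assms in auto)
  then show ?thesis using assms by simp
qed

section \<open>Primitive idempotents are orthogonal and Hermitian\<close>

context comm_scheme
begin

lemma adjoint_in: "M \<in> algebra \<Longrightarrow> adjoint_mat M \<in> algebra"
  unfolding in_algebra_iff[of "adjoint_mat M"] unfolding adjoint_mat_def vec_lambda_beta
  by (intro ballI allI impI arg_cong[where f = cnj], rule algebra_nth_eq[OF _ converse_in]) auto

abbreviation idempotents :: "(complex^'a^'a) set" where
  "idempotents \<equiv> primitive_idempotents algebra"

lemma idempotentD:
  assumes "F \<in> idempotents"
  shows "F \<in> algebra" "F \<noteq> 0" "F ** F = F"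
  using assms by (auto simp: primitive_idempotents_def)

text \<open>Otherwise \<open>E ** F\<close> and \<open>E - E ** F\<close> would be nonzero
  orthogonal idempotents of the algebra with sum \<open>E\<close>, against primitivity.\<close>

lemma idempotent_absorb:
  assumes E: "E \<in> idempotents" and F: "F \<in> algebra" "F ** F = F"
  shows "E ** F = 0 \<or> E ** F = E"
proof (rule ccontr)
  note E' = idempotentD[OF E]
  define G where "G = E ** F"
  have comm: "F ** E = G" using mult_commute E' F unfolding G_def by metis
  have EG: "E ** G = G" unfolding G_def by (simp add: matrix_mul_assoc E')
  have GE: "G ** E = G" using comm E' by (metis matrix_mul_assoc)
  have GG: "G ** G = G"
    using EG comm F by (metis G_def matrix_mul_assoc)
  have sub: "M ** (N - K) = M ** N - M ** K" "(N - K) ** M = N ** M - K ** M"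
    for M N K :: "complex^'a^'a"
    by (simp_all add: matrix_matrix_mult_def vec_eq_iff algebra_simps sum_subtractf)
  assume "\<not> (E ** F = 0 \<or> E ** F = E)"
  then have "G \<noteq> 0" "E - G \<noteq> 0" by (auto simp: G_def)
  moreover have "G \<in> algebra" "E - G \<in> algebra"
    using E' F by (simp_all add: G_def mult_in diff_in)
  moreover have "(E - G) ** (E - G) = E - G" "G ** (E - G) = 0" "(E - G) ** G = 0"
      "E = G + (E - G)"
    by (simp_all add: sub EG GE GG E')
  ultimately show False
    using E GG unfolding primitive_idempotents_def by blast
qed

text \<open>If the common value of \<open>E ** F\<close> and \<open>F ** E\<close> were nonzero,
  absorption on either side would make it equal to both \<open>E\<close> and
  \<open>F\<close>.\<close>

lemma idempotents_orthogonal: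
  assumes "E \<in> idempotents" "F \<in> idempotents" "E \<noteq> F"
  shows "E ** F = 0"
  using assms idempotent_absorb[of E F] idempotent_absorb[of F E] idempotentD mult_commute
  by metis

text \<open>The adjoint preserves the algebra and reverses products, so a splitting of
  \<open>adjoint_mat E\<close> would pull back to a splitting of \<open>E\<close>.\<close>

lemma adjoint_idempotent:
  assumes E: "E \<in> idempotents"
  shows "adjoint_mat E \<in> idempotents"
proof -
  have "\<not> (\<exists>F\<in>algebra. \<exists>F'\<in>algebra. F \<noteq> 0 \<and> F' \<noteq> 0 \<and> F ** F = F \<and> F' ** F' = F' \<and>
    F ** F' = 0 \<and> F' ** F = 0 \<and> adjoint_mat E = F + F')"
  proof (intro notI, elim bexE conjE)
    fix F F'
    assume F: "F \<in> algebra" "F' \<in> algebra" "F \<noteq> 0" "F' \<noteq> 0" "F ** F = F" "F' ** F' = F'"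
      "F ** F' = 0" "F' ** F = 0" "adjoint_mat E = F + F'"
    let ?F = "adjoint_mat F" and ?F' = "adjoint_mat F'"
    have "?F \<in> algebra" "?F' \<in> algebra" "?F \<noteq> 0" "?F' \<noteq> 0" "?F ** ?F = ?F" "?F' ** ?F' = ?F'"
      "?F ** ?F' = 0" "?F' ** ?F = 0" "E = ?F + ?F'"
      using F by (simp_all add: adjoint_in flip: adjoint_mat_mult adjoint_mat_add)
        (metis F(9) adjoint_mat_adjoint_mat)
    then show False using E unfolding primitive_idempotents_def by blast
  qed
  then show ?thesis
    using idempotentD[OF E]
    by (simp add: primitive_idempotents_def adjoint_in flip: adjoint_mat_mult)
qed

text \<open>If \<open>E\<close> differed from its adjoint, orthogonality of the two would give
  \<open>E ** adjoint_mat E = 0\<close> and hence \<open>E = 0\<close>.\<close>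

lemma idempotent_hermitian: "E \<in> idempotents \<Longrightarrow> adjoint_mat E = E"
  using idempotents_orthogonal adjoint_idempotent mult_adjoint_mat_eq_0 idempotentD(2) by metis

end

section \<open>Thin relations\<close>

lemma in_relcomp_iff: "(x, y) \<in> S O T \<longleftrightarrow> (\<exists>z. (x, z) \<in> S \<and> (z, y) \<in> T)"
  by auto

lemma nonempty_iff_card: "X \<noteq> {} \<longleftrightarrow> card X \<noteq> 0" for X :: "'a::finite set"
  by simp

context comm_scheme
begin

text \<open>Composition records only whether the number of paths is nonzero, and that number is
  symmetric in \<open>S\<close> and \<open>T\<close>.\<close>

lemma relcomp_commute: "S \<in> Rs \<Longrightarrow> T \<in> Rs \<Longrightarrow> S O T = T O S"
proof -
  have "S O T \<subseteq> T O S" if "S \<in> Rs" "T \<in> Rs" for S T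
  proof
    fix p assume "p \<in> S O T"
    then obtain x y where p: "p = (x, y)" and "{z. (x, z) \<in> S \<and> (z, y) \<in> T} \<noteq> {}" by auto
    then have "{z. (x, z) \<in> T \<and> (z, y) \<in> S} \<noteq> {}"
      by (simp only: not_False_eq_True nonempty_iff_card card_paths_commute[OF that, of x y])
    then show "p \<in> T O S" using p by auto
  qed
  then show "S \<in> Rs \<Longrightarrow> T \<in> Rs \<Longrightarrow> S O T = T O S" by blast
qed

text \<open>The number of paths is constant on \<open>T\<close>, so one pair joined by a path forces
  all pairs of \<open>T\<close> to be joined.\<close>

lemma subset_relcomp:
  assumes "S \<in> Rs" "S' \<in> Rs" "T \<in> Rs" "(x, y) \<in> T" "(x, y) \<in> S O S'"
  shows "T \<subseteq> S O S'"
proof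
  fix p assume "p \<in> T"
  then obtain x' y' where p: "p = (x', y')" "(x', y') \<in> T" by (cases p) auto
  have "{z. (x, z) \<in> S \<and> (z, y) \<in> S'} \<noteq> {}" using assms by auto
  then have "{z. (x', z) \<in> S \<and> (z, y') \<in> S'} \<noteq> {}"
    by (simp only: not_False_eq_True nonempty_iff_card card_paths_eq[OF assms(1-4) p(2)])
  then show "p \<in> S O S'" using p by auto
qed

definition thins :: "('a \<times> 'a) set set" where
  "thins = {S \<in> Rs. thin UNIV S}"

lemma thins_subset: "A \<in> thins \<Longrightarrow> A \<in> Rs"
  by (simp add: thins_def)

text \<open>The out-degree counts closed paths along \<open>S\<close> and then its converse, a
  number constant on \<open>Id\<close>. Commutativity exchanges the two factors and turns it into
  the in-degree.\<close>

lemma card_image_eq_card_preimage: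
  assumes "S \<in> Rs"
  shows "card {z. (x, z) \<in> S} = card {z. (z, y) \<in> S}"
proof -
  have "card {z. (x, z) \<in> S} = card {z. (x, z) \<in> S \<and> (z, x) \<in> S\<inverse>}" by simp
  also have "\<dots> = card {z. (y, z) \<in> S \<and> (z, y) \<in> S\<inverse>}"
    using assms Id_in converse_in by (intro card_paths_eq[of _ _ Id]) auto
  also have "\<dots> = card {z. (y, z) \<in> S\<inverse> \<and> (z, y) \<in> S}"
    using assms converse_in by (intro card_paths_commute) auto
  finally show ?thesis by simp
qed

text \<open>Thinness prescribes out-degrees only; equality with the in-degrees makes thin relations
  graphs of permutations.\<close>

lemma thins_iff:
  "S \<in> thins \<longleftrightarrow> S \<in> Rs \<and> (\<forall>x. \<exists>!y. (x, y) \<in> S) \<and> (\<forall>y. \<exists>!x. (x, y) \<in> S)"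
proof -
  have one: "card {z. Q z} = 1 \<longleftrightarrow> (\<exists>!z. Q z)" for Q :: "'a \<Rightarrow> bool"
    unfolding One_nat_def card_1_singleton_iff set_eq_iff mem_Collect_eq singleton_iff Ex1_def
    by blast
  have "S \<in> Rs \<Longrightarrow> (\<forall>x. card {y. (x, y) \<in> S} = 1) \<Longrightarrow> (\<forall>y. card {x. (x, y) \<in> S} = 1)"
    using card_image_eq_card_preimage by metis
  then show ?thesis
    unfolding thins_def thin_def has_valency_def one[symmetric] by auto
qed

lemma thin_image: "A \<in> thins \<Longrightarrow> \<exists>!y. (x, y) \<in> A"
  and thin_preimage: "A \<in> thins \<Longrightarrow> \<exists>!x. (x, y) \<in> A"
  unfolding thins_iff by simp_all

lemma Id_thin: "Id \<in> thins"
  using Id_in by (auto simp: thins_iff)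

lemma converse_thin: "A \<in> thins \<Longrightarrow> A\<inverse> \<in> thins"
  using converse_in by (simp add: thins_iff)

lemma thin_relcomp_converse:
  assumes "A \<in> thins"
  shows "A O A\<inverse> = Id" "A\<inverse> O A = Id"
proof -
  note img = thin_image[OF assms] and pre = thin_preimage[OF assms]
  have "(x, y) \<in> A O A\<inverse> \<longleftrightarrow> x = y" "(x, y) \<in> A\<inverse> O A \<longleftrightarrow> x = y" for x y
    unfolding in_relcomp_iff converse_iff by (metis img pre)+
  then show "A O A\<inverse> = Id" "A\<inverse> O A = Id" by (simp_all add: set_eq_iff)
qed

text \<open>Let \<open>T\<close> be the relation of one pair in \<open>A O S\<close>. Constancy of
  path numbers gives \<open>T \<subseteq> A O S\<close> and also
  \<open>S \<subseteq> A\<inverse> O T\<close>; composing the latter with \<open>A\<close> yields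
  the reverse inclusion.\<close>

lemma thin_relcomp_in:
  assumes A: "A \<in> thins" and S: "S \<in> Rs"
  shows "A O S \<in> Rs"
proof -
  obtain z y where zy: "(z, y) \<in> S" using nonempty[OF S] by auto
  obtain x where xz: "(x, z) \<in> A" using thin_preimage[OF A] by blast
  obtain T where T: "T \<in> Rs" "(x, y) \<in> T" by (rule obtain_rel)
  have "T \<subseteq> A O S"
    using subset_relcomp[OF thins_subset[OF A] S T] xz zy by blast
  moreover have "S \<subseteq> A\<inverse> O T"
    using subset_relcomp[OF thins_subset[OF converse_thin[OF A]] T(1) S zy] xz T(2) by blast
  then have "A O S \<subseteq> A O A\<inverse> O T" by blast
  then have "A O S \<subseteq> T"
    using thin_relcomp_converse(1)[OF A] by (simp flip: O_assoc)
  ultimately show ?thesis using T by auto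
qed

lemma thin_relcomp_thin:
  assumes "A \<in> thins" "B \<in> thins"
  shows "A O B \<in> thins"
proof -
  have "A O B \<in> Rs" using thin_relcomp_in assms thins_subset by blast
  moreover have "\<exists>!y. (x, y) \<in> A O B" for x
    unfolding in_relcomp_iff by (metis assms thin_image)
  moreover have "\<exists>!x. (x, y) \<in> A O B" for y
    unfolding in_relcomp_iff by (metis assms thin_preimage)
  ultimately show ?thesis unfolding thins_iff by blast
qed

text \<open>A thin \<open>A\<close> leaves a single intermediate point, so every entry of the matrix
  product counts at most one path.\<close>

lemma adj_mat_relcomp:
  assumes "A \<in> thins"
  shows "adj_mat (A O S) = adj_mat A ** adj_mat S"
proof -
  have "(adj_mat A ** adj_mat S) $ x $ y = adj_mat (A O S) $ x $ y" for x y
  proof -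
    obtain u where u: "\<And>z. (x, z) \<in> A \<longleftrightarrow> z = u" using thin_image[OF assms] by metis
    have "(adj_mat A ** adj_mat S) $ x $ y = (\<Sum>z\<in>UNIV. if z = u then of_bool ((u, y) \<in> S) else 0)"
      by (auto simp: matrix_matrix_mult_def adj_mat_def u intro!: sum.cong)
    then show ?thesis by (simp add: adj_mat_def in_relcomp_iff u)
  qed
  then show ?thesis by (simp add: vec_eq_iff)
qed

end

lemma adj_mat_inject: "adj_mat S = adj_mat T \<longleftrightarrow> S = T"
  by (auto simp: adj_mat_def vec_eq_iff set_eq_iff)

section \<open>Matrices over the group algebra of the thin radical\<close>

lemma (in group) ga_mult_eq:
  assumes "finite (carrier G)"
  shows "ga_mult G a b x = (if x \<in> carrier G then \<Sum>h\<in>carrier G. a (x \<otimes> inv h) * b h else 0)"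
proof (cases "x \<in> carrier G")
  case True
  have "ga_mult G a b x =
      (\<Sum>h\<in>carrier G. \<Sum>g\<in>carrier G. a g * b h * of_bool (x = g \<otimes> h))"
    unfolding ga_mult_def by (rule sum.swap)
  also have "\<dots> = (\<Sum>h\<in>carrier G. \<Sum>g\<in>carrier G. if g = x \<otimes> inv h then a g * b h else 0)"
  proof (intro sum.cong refl)
    fix g h assume "h \<in> carrier G" "g \<in> carrier G"
    then have "x = g \<otimes> h \<longleftrightarrow> g = x \<otimes> inv h" using True inv_solve_right by blast
    then show "a g * b h * of_bool (x = g \<otimes> h) = (if g = x \<otimes> inv h then a g * b h else 0)"
      by simp
  qed
  also have "\<dots> = (\<Sum>h\<in>carrier G. a (x \<otimes> inv h) * b h)"
    using assms True by simp
  finally show ?thesis using True by simp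
next
  case False
  then have "ga_mult G a b x = (\<Sum>g\<in>carrier G. \<Sum>h\<in>carrier G. 0)"
    unfolding ga_mult_def by (intro sum.cong refl) auto
  then show ?thesis using False by simp
qed

lemma (in group) ga_mult_ga_elem:
  assumes "finite (carrier G)" "g \<in> carrier G"
  shows "ga_mult G (ga_elem g) b x = (if x \<in> carrier G then b (inv g \<otimes> x) else 0)"
proof (cases "x \<in> carrier G")
  case True
  have "(\<Sum>h\<in>carrier G. ga_elem g (x \<otimes> inv h) * b h) =
      (\<Sum>h\<in>carrier G. if h = inv g \<otimes> x then b h else 0)"
  proof (intro sum.cong refl)
    fix h assume h: "h \<in> carrier G"
    have "x \<otimes> inv h = g \<longleftrightarrow> x = g \<otimes> h" using True assms h inv_solve_right[of g x h] by metis
    also have "\<dots> \<longleftrightarrow> h = inv g \<otimes> x" using True assms h inv_solve_left[of h g x] by metis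
    finally show "ga_elem g (x \<otimes> inv h) * b h = (if h = inv g \<otimes> x then b h else 0)"
      by (simp add: ga_elem_def)
  qed
  then show ?thesis using True assms by (simp add: ga_mult_eq)
qed (simp add: ga_mult_eq assms)

lemma (in group) regular_rep_eq:
  assumes "finite (carrier G)" "h \<in> carrier G" "k \<in> carrier G"
  shows "regular_rep G a h k = a (h \<otimes> inv k)"
proof -
  have "regular_rep G a h k = (\<Sum>g\<in>carrier G. if g = h \<otimes> inv k then a g else 0)"
    unfolding regular_rep_def
  proof (intro sum.cong refl)
    fix g assume "g \<in> carrier G"
    then have "h = g \<otimes> k \<longleftrightarrow> g = h \<otimes> inv k" using assms inv_solve_right by blast
    then show "a g * of_bool (h = g \<otimes> k) = (if g = h \<otimes> inv k then a g else 0)" by simp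
  qed
  then show ?thesis using assms by simp
qed

text \<open>
  Numbering the thin relations by \<open>{..<r}\<close> turns the thin radical into a group on natural numbers,
  which acts on the points without fixed points; \<open>w\<close> picks one point in each of the \<open>n\<close> orbits.
\<close>

locale roux_coordinates = comm_scheme Rs for Rs :: "('a::finite \<times> 'a) set set" +
  fixes R :: "nat \<Rightarrow> ('a \<times> 'a) set" and r n :: nat and w :: "nat \<Rightarrow> 'a"
  assumes R: "bij_betw R {..<r} thins"
    and w: "\<And>x. \<exists>!i. i < n \<and> (\<exists>A\<in>thins. (x, w i) \<in> A)"
begin

definition G :: "nat monoid" where
  "G = \<lparr>carrier = {..<r}, mult = (\<lambda>g h. inv_into {..<r} R (R g O R h)),
        one = inv_into {..<r} R Id\<rparr>"

lemma carrier_G [simp]: "carrier G = {..<r}"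
  by (simp add: G_def)

lemma R_thin: "g < r \<Longrightarrow> R g \<in> thins"
  using R by (auto simp: bij_betw_def)

lemma R_in: "g < r \<Longrightarrow> R g \<in> Rs"
  using R_thin thins_subset by blast

lemma R_inject: "g < r \<Longrightarrow> h < r \<Longrightarrow> R g = R h \<longleftrightarrow> g = h"
  using R by (auto simp: bij_betw_def inj_on_def)

lemma R_inv_into: "A \<in> thins \<Longrightarrow> R (inv_into {..<r} R A) = A"
  using R by (intro f_inv_into_f) (simp add: bij_betw_def)

lemma inv_into_less: "A \<in> thins \<Longrightarrow> inv_into {..<r} R A < r"
  using R inv_into_into[of A R "{..<r}"] by (simp add: bij_betw_def)

lemma R_mult: "g < r \<Longrightarrow> h < r \<Longrightarrow> R (g \<otimes>\<^bsub>G\<^esub> h) = R g O R h"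
  by (simp add: G_def R_inv_into R_thin thin_relcomp_thin)

lemma R_one: "R \<one>\<^bsub>G\<^esub> = Id"
  by (simp add: G_def R_inv_into Id_thin)

lemma mult_less: "g < r \<Longrightarrow> h < r \<Longrightarrow> g \<otimes>\<^bsub>G\<^esub> h < r"
  by (simp add: G_def inv_into_less R_thin thin_relcomp_thin)

lemma one_less: "\<one>\<^bsub>G\<^esub> < r"
  by (simp add: G_def inv_into_less Id_thin)

text \<open>The laws hold for composition of thin relations, with the converse as inverse, and pull
  back along the injective numbering \<open>R\<close>.\<close>

lemma comm_group_G: "comm_group G"
proof -
  have eqI: "x = y" if "x < r" "y < r" "R x = R y" for x y using that R_inject by blast
  show ?thesis
  proof (rule comm_groupI, unfold carrier_G lessThan_iff)
    show "\<one>\<^bsub>G\<^esub> < r" by (rule one_less)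
  next
    fix g h assume gh: "g < r" "h < r"
    show "g \<otimes>\<^bsub>G\<^esub> h < r" using gh by (rule mult_less)
    have "R g O R h = R h O R g" using relcomp_commute R_in gh by blast
    then show "g \<otimes>\<^bsub>G\<^esub> h = h \<otimes>\<^bsub>G\<^esub> g" by (simp add: G_def)
  next
    fix g h k assume "g < r" "h < r" "k < r"
    then show "g \<otimes>\<^bsub>G\<^esub> h \<otimes>\<^bsub>G\<^esub> k = g \<otimes>\<^bsub>G\<^esub> (h \<otimes>\<^bsub>G\<^esub> k)"
      by (intro eqI) (simp_all add: R_mult mult_less O_assoc)
  next
    fix g assume g: "g < r"
    then show "\<one>\<^bsub>G\<^esub> \<otimes>\<^bsub>G\<^esub> g = g"
      by (intro eqI) (simp_all add: R_mult R_one mult_less one_less)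
    define h where "h = inv_into {..<r} R ((R g)\<inverse>)"
    have h: "h < r" "R h = (R g)\<inverse>"
      using converse_thin[OF R_thin[OF g]] by (simp_all add: h_def inv_into_less R_inv_into)
    then have "h \<otimes>\<^bsub>G\<^esub> g = \<one>\<^bsub>G\<^esub>"
      using g thin_relcomp_converse(2)[OF R_thin[OF g]]
      by (intro eqI) (simp_all add: R_mult R_one mult_less one_less)
    then show "\<exists>h\<in>{..<r}. h \<otimes>\<^bsub>G\<^esub> g = \<one>\<^bsub>G\<^esub>" using h by blast
  qed
qed

interpretation G: comm_group G
  by (rule comm_group_G)

lemma inv_less: "g < r \<Longrightarrow> inv\<^bsub>G\<^esub> g < r"
  using G.inv_closed[of g] by simp

lemma R_inv: "g < r \<Longrightarrow> R (inv\<^bsub>G\<^esub> g) = (R g)\<inverse>"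
proof -
  assume g: "g < r"
  have "R (inv\<^bsub>G\<^esub> g) = R (inv\<^bsub>G\<^esub> g) O R g O (R g)\<inverse>"
    using thin_relcomp_converse(1)[OF R_thin[OF g]] by simp
  also have "\<dots> = R (inv\<^bsub>G\<^esub> g \<otimes>\<^bsub>G\<^esub> g) O (R g)\<inverse>"
    by (simp only: R_mult[OF inv_less[OF g] g] O_assoc)
  finally show ?thesis using g by (simp add: R_one)
qed

text \<open>The moved point stands on the left of the pair, which makes this a left action:
  composing relations corresponds to composing maps in the same order.\<close>

definition act :: "nat \<Rightarrow> 'a \<Rightarrow> 'a" where
  "act g y = (THE x. (x, y) \<in> R g)"

lemma act_iff: "g < r \<Longrightarrow> (x, y) \<in> R g \<longleftrightarrow> x = act g y"
  unfolding act_def using theI'[OF thin_preimage[OF R_thin, of g y]] thin_preimage[OF R_thin, of g y]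
  by blast

lemma act_mult: "g < r \<Longrightarrow> h < r \<Longrightarrow> act (g \<otimes>\<^bsub>G\<^esub> h) y = act g (act h y)"
  by (metis R_mult act_iff in_relcomp_iff mult_less)

lemma act_one: "act \<one>\<^bsub>G\<^esub> y = y"
  by (metis R_one act_iff one_less pair_in_Id_conv)

lemma act_inv: "g < r \<Longrightarrow> (x, y) \<in> R g \<longleftrightarrow> y = act (inv\<^bsub>G\<^esub> g) x"
  using act_iff[OF inv_less, of g y x] by (simp add: R_inv)

text \<open>Each point lies in the orbit of only one representative. The action is free because a
  pair of points lies in only one relation.\<close>

lemma act_w_inject:
  assumes "i < n" "j < n" "g < r" "h < r"
  shows "act g (w i) = act h (w j) \<longleftrightarrow> i = j \<and> g = h"
proof
  assume eq: "act g (w i) = act h (w j)"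
  have 1: "(act g (w i), w i) \<in> R g" "(act g (w i), w j) \<in> R h"
    using assms by (simp_all add: act_iff eq)
  then have "i = j" using w[of "act g (w i)"] assms R_thin by blast
  moreover have "R g = R h" using rel_eqI 1 assms \<open>i = j\<close> R_in by metis
  ultimately show "i = j \<and> g = h" using assms R_inject by blast
qed simp

text \<open>These are the coordinates that identify the points of the scheme with those of the roux
  scheme.\<close>

lemma act_w_bij: "bij_betw (\<lambda>(i, g). act g (w i)) ({..<n} \<times> {..<r}) UNIV"
proof -
  have "x \<in> (\<lambda>(i, g). act g (w i)) ` ({..<n} \<times> {..<r})" for x
  proof -
    obtain i A where "i < n" "A \<in> thins" "(x, w i) \<in> A" using w by blast
    moreover obtain g where "g < r" "A = R g"
      using R \<open>A \<in> thins\<close> by (auto simp: bij_betw_def)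
    ultimately show ?thesis using act_iff by force
  qed
  then show ?thesis
    by (auto simp: bij_betw_def inj_on_def act_w_inject)
qed

text \<open>Thin relations commute with every \<open>T\<close>. The path from \<open>act g x\<close>
  through \<open>x\<close> to \<open>y\<close> can thus be traversed with the \<open>T\<close> step
  first, and its middle point is then \<open>act g y\<close>.\<close>

lemma algebra_act:
  assumes M: "M \<in> algebra" and g: "g < r"
  shows "M $ act g x $ act g y = M $ x $ y"
proof -
  obtain T where T: "T \<in> Rs" "(x, y) \<in> T" by (rule obtain_rel)
  have "(act g x, x) \<in> R g" using act_iff g by blast
  then have "(act g x, y) \<in> T O R g"
    using T relcomp_commute[OF R_in[OF g] T(1)] by blast
  then have "(act g x, act g y) \<in> T" using act_iff g by (auto simp: in_relcomp_iff)
  then show ?thesis using algebra_nth_eq M T by blast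
qed

text \<open>
  The inverse of \<open>regular_lift\<close> on the adjacency algebra: a matrix in the algebra commutes with the
  action, so its orbit blocks are determined by the columns of the representatives.
\<close>

definition coeff_mat :: "complex^'a^'a \<Rightarrow> nat ga_mat" where
  "coeff_mat M = (\<lambda>i j x. if i < n \<and> j < n \<and> x < r then M $ act x (w i) $ w j else 0)"

text \<open>Translating both points by the inverse of \<open>h\<close> leaves the entry unchanged.
  It therefore depends on \<open>g\<close> and \<open>h\<close> only through their quotient, as in
  the regular representation.\<close>

lemma coeff_mat_nth:
  assumes "M \<in> algebra" "i < n" "j < n" "g < r" "h < r"
  shows "M $ act g (w i) $ act h (w j) = coeff_mat M i j (g \<otimes>\<^bsub>G\<^esub> inv\<^bsub>G\<^esub> h)"
proof -
  have "g = h \<otimes>\<^bsub>G\<^esub> (g \<otimes>\<^bsub>G\<^esub> inv\<^bsub>G\<^esub> h)"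
    using assms G.inv_closed G.r_inv
    by (metis G.inv_solve_right' G.m_closed G.m_comm carrier_G lessThan_iff)
  then have "act g (w i) = act h (act (g \<otimes>\<^bsub>G\<^esub> inv\<^bsub>G\<^esub> h) (w i))"
    using assms by (metis act_mult inv_less mult_less)
  then show ?thesis using assms by (simp add: coeff_mat_def algebra_act mult_less inv_less)
qed

lemma coeff_mat_inj_on: "inj_on coeff_mat algebra"
proof (rule inj_onI)
  fix M N assume MN: "M \<in> algebra" "N \<in> algebra" "coeff_mat M = coeff_mat N"
  have "M $ x $ y = N $ x $ y" for x y
  proof -
    have "x \<in> (\<lambda>(i, g). act g (w i)) ` ({..<n} \<times> {..<r})"
        "y \<in> (\<lambda>(i, g). act g (w i)) ` ({..<n} \<times> {..<r})"
      using act_w_bij unfolding bij_betw_def by simp_all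
    then obtain i g j h where "i < n" "j < n" "g < r" "h < r" "x = act g (w i)" "y = act h (w j)"
      by auto
    then show ?thesis using MN by (simp add: coeff_mat_nth)
  qed
  then show "M = N" by (simp add: vec_eq_iff)
qed

text \<open>The sum over orbits \<open>k\<close> and group elements \<open>h\<close> in the
  convolution is the sum over all intermediate points, written in coordinates.\<close>

lemma coeff_mat_mult:
  assumes M: "M \<in> algebra" and N: "N \<in> algebra"
  shows "ga_mat_mult G n (coeff_mat M) (coeff_mat N) = coeff_mat (M ** N)"
proof (intro ext)
  fix i j x
  show "ga_mat_mult G n (coeff_mat M) (coeff_mat N) i j x = coeff_mat (M ** N) i j x"
  proof (cases "i < n \<and> j < n \<and> x < r")
    case True
    let ?pt = "\<lambda>(k, h). act h (w k)"
    have "ga_mat_mult G n (coeff_mat M) (coeff_mat N) i j x =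
        (\<Sum>k<n. \<Sum>h<r. coeff_mat M i k (x \<otimes>\<^bsub>G\<^esub> inv\<^bsub>G\<^esub> h) * coeff_mat N k j h)"
      using True by (simp add: ga_mat_mult_def G.ga_mult_eq)
    also have "\<dots> = (\<Sum>k<n. \<Sum>h<r. M $ act x (w i) $ act h (w k) * N $ act h (w k) $ w j)"
      using True by (intro sum.cong refl) (simp add: coeff_mat_nth M, simp add: coeff_mat_def)
    also have "\<dots> = (\<Sum>p\<in>{..<n} \<times> {..<r}. M $ act x (w i) $ ?pt p * N $ ?pt p $ w j)"
      by (simp add: sum.cartesian_product case_prod_unfold)
    also have "\<dots> = (\<Sum>z\<in>UNIV. M $ act x (w i) $ z * N $ z $ w j)"
      by (rule sum.reindex_bij_betw[OF act_w_bij])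
    finally show ?thesis using True by (simp add: coeff_mat_def matrix_matrix_mult_def)
  next
    case False
    then show ?thesis
      by (auto simp: ga_mat_mult_def G.ga_mult_eq coeff_mat_def intro!: sum.neutral)
  qed
qed

lemma adj_R_mult_nth: "g < r \<Longrightarrow> (adj_mat (R g) ** M) $ x $ y = M $ act (inv\<^bsub>G\<^esub> g) x $ y"
proof -
  assume g: "g < r"
  have "(adj_mat (R g) ** M) $ x $ y =
      (\<Sum>z\<in>UNIV. if z = act (inv\<^bsub>G\<^esub> g) x then M $ z $ y else 0)"
    by (auto simp: matrix_matrix_mult_def adj_mat_def act_inv[OF g] intro!: sum.cong)
  then show ?thesis by simp
qed

text \<open>Multiplying by \<open>g\<close> in the group algebra shifts coefficients just as the
  permutation matrix of \<open>R g\<close> permutes rows.\<close>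

lemma scale_coeff_mat:
  assumes "g < r"
  shows "ga_mat_scale G g (coeff_mat M) = coeff_mat (adj_mat (R g) ** M)"
proof (intro ext)
  fix i j x
  show "ga_mat_scale G g (coeff_mat M) i j x = coeff_mat (adj_mat (R g) ** M) i j x"
    using assms
    by (auto simp: ga_mat_scale_def G.ga_mult_ga_elem coeff_mat_def adj_R_mult_nth
        mult_less inv_less act_mult)
qed

lemma coeff_mat_one: "coeff_mat (mat 1) = ga_mat_id G n"
proof (intro ext)
  fix i j x
  have "act x (w i) = w j \<longleftrightarrow> i = j \<and> x = \<one>\<^bsub>G\<^esub>" if "i < n" "j < n" "x < r"
    using act_w_inject[of i j x "\<one>\<^bsub>G\<^esub>"] that one_less by (simp add: act_one)
  then show "coeff_mat (mat 1) i j x = ga_mat_id G n i j x"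
    using one_less by (auto simp: coeff_mat_def ga_mat_id_def mat_def ga_elem_def)
qed

text \<open>The span is a sum over a set of matrices. Injectivity on the algebra keeps the matrices
  of distinct relations distinct, so coefficients can be passed between relations and
  matrices.\<close>

lemma span_coeff_mat:
  "ga_mat_span ((\<lambda>S. coeff_mat (adj_mat S)) ` Rs) = coeff_mat ` algebra"
proof -
  let ?f = "\<lambda>S. coeff_mat (adj_mat S)"
  have inj: "inj_on ?f Rs"
    using inj_onD[OF coeff_mat_inj_on _ adj_mat_in adj_mat_in]
    by (intro inj_onI) (simp add: adj_mat_inject)
  have sum: "coeff_mat (\<Sum>S\<in>Rs. mat_scale (c S) (adj_mat S)) = (\<lambda>i j x. \<Sum>S\<in>Rs. c S * ?f S i j x)"
    for c
    by (intro ext) (auto simp: coeff_mat_def mat_scale_def intro!: sum.neutral)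
  show ?thesis
  proof (intro subset_antisym subsetI)
    fix M assume "M \<in> ga_mat_span (?f ` Rs)"
    then obtain c where "M = (\<lambda>i j x. \<Sum>N\<in>?f ` Rs. c N * N i j x)"
      unfolding ga_mat_span_def by blast
    then have "M = (\<lambda>i j x. \<Sum>S\<in>Rs. c (?f S) * ?f S i j x)"
      by (simp add: sum.reindex[OF inj])
    then have "M = coeff_mat (\<Sum>S\<in>Rs. mat_scale (c (?f S)) (adj_mat S))"
      by (simp only: sum[of "\<lambda>S. c (?f S)"])
    moreover have "(\<Sum>S\<in>Rs. mat_scale (c (?f S)) (adj_mat S)) \<in> algebra"
      unfolding adjacency_algebra_def by (intro CollectI exI) (rule refl)
    ultimately show "M \<in> coeff_mat ` algebra" by simp
  next
    fix M assume "M \<in> coeff_mat ` algebra"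
    then obtain c where "M = coeff_mat (\<Sum>S\<in>Rs. mat_scale (c S) (adj_mat S))"
      unfolding adjacency_algebra_def by blast
    then have "M = (\<lambda>i j x. \<Sum>N\<in>?f ` Rs. c (inv_into Rs ?f N) * N i j x)"
      by (simp add: sum sum.reindex[OF inj] inv_into_f_f[OF inj])
    then show "M \<in> ga_mat_span (?f ` Rs)"
      unfolding ga_mat_span_def by (intro CollectI exI)
  qed
qed

lemma regular_lift_coeff_mat:
  assumes "M \<in> algebra" "i < n" "j < n" "h < r" "k < r"
  shows "regular_lift G (coeff_mat M) (i, h) (j, k) = M $ act h (w i) $ act k (w j)"
  using assms by (simp add: regular_lift_def G.regular_rep_eq coeff_mat_nth)

text \<open>The isomorphism \<open>f\<close> sends a point to its coordinates. The lift of the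
  coefficient matrix of \<open>T\<close> is the adjacency matrix of \<open>T\<close> in these
  coordinates, so the roux relations are exactly the images of the relations in
  \<open>Rs\<close>.\<close>

lemma scheme_isomorphic_roux_relations:
  assumes basis: "roux_basis G n B = (\<lambda>S. coeff_mat (adj_mat S)) ` Rs"
  shows "scheme_isomorphic UNIV Rs (roux_points G n) (roux_relations G n B)"
proof -
  define X where "X = {..<n} \<times> {..<r}"
  define pt where "pt = (\<lambda>(i, g). act g (w i))"
  define f where "f = inv_into X pt"
  have points: "roux_points G n = X" by (simp add: roux_points_def X_def)
  have pt: "bij_betw pt X UNIV" unfolding pt_def X_def by (rule act_w_bij)
  have f: "bij_betw f UNIV X" unfolding f_def using pt by (rule bij_betw_inv_into)
  have pt_f: "pt (f x) = x" for x
    using bij_betw_inv_into_right[OF pt] by (simp add: f_def)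
  have f_pt: "f (pt p) = p" if "p \<in> X" for p
    using bij_betw_inv_into_left[OF pt that] by (simp add: f_def)
  have f_in: "f x \<in> X" for x using bij_betwE[OF f] by simp
  have image: "(p, q) \<in> map_prod f f ` T \<longleftrightarrow> p \<in> X \<and> q \<in> X \<and> (pt p, pt q) \<in> T" for p q T
  proof
    assume "(p, q) \<in> map_prod f f ` T"
    then obtain x y where "(x, y) \<in> T" "p = f x" "q = f y" by auto
    then show "p \<in> X \<and> q \<in> X \<and> (pt p, pt q) \<in> T" by (simp add: f_in pt_f)
  next
    assume pq: "p \<in> X \<and> q \<in> X \<and> (pt p, pt q) \<in> T"
    show "(p, q) \<in> map_prod f f ` T"
      by (rule image_eqI[of _ _ "(pt p, pt q)"]) (use pq in \<open>simp_all add: f_pt\<close>)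
  qed
  have lift: "regular_lift G (coeff_mat (adj_mat T)) p q = of_bool Q \<longleftrightarrow>
      ((pt p, pt q) \<in> T \<longleftrightarrow> Q)"
    if "T \<in> Rs" "p \<in> X" "q \<in> X" for T p q Q
    using that
    by (auto simp: X_def pt_def regular_lift_coeff_mat adj_mat_in) (auto simp: adj_mat_def)
  have subset: "R' \<subseteq> X \<times> X \<longleftrightarrow> (\<forall>p q. (p, q) \<in> R' \<longrightarrow> p \<in> X \<and> q \<in> X)" for R'
    by auto
  have "R' \<in> roux_relations G n B \<longleftrightarrow> R' \<in> (\<lambda>T. map_prod f f ` T) ` Rs" for R'
  proof -
    have "R' \<in> roux_relations G n B \<longleftrightarrow> R' \<subseteq> X \<times> X \<and>
        (\<exists>T\<in>Rs. \<forall>p\<in>X. \<forall>q\<in>X.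
          regular_lift G (coeff_mat (adj_mat T)) p q = of_bool ((p, q) \<in> R'))"
      unfolding roux_relations_def points basis by simp
    also have "\<dots> \<longleftrightarrow> R' \<subseteq> X \<times> X \<and> (\<exists>T\<in>Rs. \<forall>p\<in>X. \<forall>q\<in>X. (pt p, pt q) \<in> T \<longleftrightarrow> (p, q) \<in> R')"
      by (simp only: lift cong: ball_cong bex_cong)
    also have "\<dots> \<longleftrightarrow> (\<exists>T\<in>Rs. \<forall>p q. (p, q) \<in> R' \<longleftrightarrow> p \<in> X \<and> q \<in> X \<and> (pt p, pt q) \<in> T)"
      unfolding subset by metis
    also have "\<dots> \<longleftrightarrow> (\<exists>T\<in>Rs. R' = map_prod f f ` T)"
      by (simp only: set_eq_iff split_paired_All image)
    finally show ?thesis by blast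
  qed
  then have "(\<lambda>T. map_prod f f ` T) ` Rs = roux_relations G n B" by blast
  then show ?thesis unfolding scheme_isomorphic_def points using f by blast
qed

section \<open>The roux matrix of a symmetric thick relation\<close>

context
  fixes S :: "('a \<times> 'a) set"
  assumes sym_S: "sym S"
    and S_bij: "bij_betw (\<lambda>A. A O S) thins (Rs - thins)"
begin

lemma S_thick: "S \<in> Rs" "S \<notin> thins"
proof -
  have "Id O S \<in> Rs - thins" using S_bij Id_thin unfolding bij_betw_def by blast
  then show "S \<in> Rs" "S \<notin> thins" by simp_all
qed

text \<open>Multiples of the identity come from the thin relations, and multiples of
  \<open>coeff_mat (adj_mat S)\<close> from the translates of \<open>S\<close>, which exhaust the
  thick ones.\<close>

lemma roux_basis_coeff_mat:
  "roux_basis G n (coeff_mat (adj_mat S)) = (\<lambda>S. coeff_mat (adj_mat S)) ` Rs"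
proof -
  have "(\<lambda>g. ga_mat_scale G g (ga_mat_id G n)) ` {..<r} = (\<lambda>g. coeff_mat (adj_mat (R g))) ` {..<r}"
    by (intro image_cong refl) (simp add: scale_coeff_mat flip: coeff_mat_one)
  also have "\<dots> = (\<lambda>S. coeff_mat (adj_mat S)) ` R ` {..<r}"
    by (simp add: image_image)
  also have "\<dots> = (\<lambda>S. coeff_mat (adj_mat S)) ` thins"
    using R by (simp add: bij_betw_def)
  finally have 1: "(\<lambda>g. ga_mat_scale G g (ga_mat_id G n)) ` {..<r} =
    (\<lambda>S. coeff_mat (adj_mat S)) ` thins" .
  have "(\<lambda>g. ga_mat_scale G g (coeff_mat (adj_mat S))) ` {..<r} =
      (\<lambda>g. coeff_mat (adj_mat (R g O S))) ` {..<r}"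
    by (intro image_cong refl) (simp add: scale_coeff_mat adj_mat_relcomp R_thin)
  also have "\<dots> = (\<lambda>S. coeff_mat (adj_mat S)) ` (\<lambda>A. A O S) ` R ` {..<r}"
    by (simp add: image_image)
  also have "\<dots> = (\<lambda>S. coeff_mat (adj_mat S)) ` (Rs - thins)"
    using R S_bij by (simp add: bij_betw_def)
  finally show ?thesis
    unfolding roux_basis_def carrier_G 1 using thins_subset by blast
qed

text \<open>Points of one orbit are joined by a thin relation, hence not by
  \<open>S\<close>.\<close>

lemma coeff_mat_diagonal: "coeff_mat (adj_mat S) i i = (\<lambda>_. 0)"
proof
  fix x
  have "(act x (w i), w i) \<notin> S" if "x < r"
    using that S_thick R_thin[OF that] rel_eqI[OF S_thick(1) R_in[OF that]] act_iff[OF that] by metis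
  then show "coeff_mat (adj_mat S) i i x = 0" by (simp add: coeff_mat_def adj_mat_def)
qed

text \<open>If \<open>x\<close> and \<open>b\<close> both occur in the block and \<open>g\<close> is
  their quotient, then \<open>R g O S\<close> meets \<open>S\<close> and so equals it. Injectivity
  of translation forces \<open>g\<close> to be the identity.\<close>

lemma coeff_mat_eq_ga_elem:
  assumes "i < n" "j < n" "b < r" and b: "(act b (w i), w j) \<in> S"
  shows "coeff_mat (adj_mat S) i j = ga_elem b"
proof
  fix x
  have eq: "x = b" if x: "x < r" "(act x (w i), w j) \<in> S"
  proof -
    define g where "g = x \<otimes>\<^bsub>G\<^esub> inv\<^bsub>G\<^esub> b"
    have g: "g < r" "g \<otimes>\<^bsub>G\<^esub> b = x"
      using x assms by (simp_all add: g_def mult_less inv_less G.m_assoc)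
    have "(act x (w i), act b (w i)) \<in> R g"
      unfolding act_iff[OF g(1)] using act_mult[OF g(1) assms(3)] g(2) by simp
    then have "(act x (w i), w j) \<in> R g O S" using b by (rule relcompI)
    then have "R g O S = S"
      using x(2) by (rule rel_eqI[OF thin_relcomp_in[OF R_thin[OF g(1)] S_thick(1)] S_thick(1)])
    then have "R g O S = Id O S" by simp
    then have "R g = Id"
      by (rule inj_onD[OF bij_betw_imp_inj_on[OF S_bij] _ R_thin[OF g(1)] Id_thin])
    then have "g = \<one>\<^bsub>G\<^esub>" using R_inject[OF g(1) one_less] R_one by simp
    then show "x = b" using g(2) assms(3) by simp
  qed
  have "coeff_mat (adj_mat S) i j x = of_bool (x < r \<and> (act x (w i), w j) \<in> S)"
    using assms by (simp add: coeff_mat_def adj_mat_def)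
  also have "\<dots> = ga_elem b x"
    unfolding ga_elem_def by (rule arg_cong[where f = of_bool]) (use eq assms in blast)
  finally show "coeff_mat (adj_mat S) i j x = ga_elem b x" .
qed

lemma coeff_mat_off_diagonal:
  assumes ij: "i < n" "j < n" "i \<noteq> j"
  shows "\<exists>b\<in>{..<r}. coeff_mat (adj_mat S) i j = ga_elem b \<and>
    coeff_mat (adj_mat S) j i = ga_elem (inv\<^bsub>G\<^esub> b)"
proof -
  \<comment> \<open>The relation \<open>T\<close> from \<open>w i\<close> to \<open>w j\<close>
    cannot be thin, since the orbits differ, so it is a translate \<open>R a O S\<close>. Moving
    \<open>a\<close> onto the left point gives the group element of the block, the inverse of
    \<open>a\<close>.\<close>
  obtain T where T: "T \<in> Rs" "(w i, w j) \<in> T" by (rule obtain_rel)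
  have "T \<notin> thins"
  proof
    assume "T \<in> thins"
    then obtain g where g: "g < r" "T = R g" using inv_into_less R_inv_into by metis
    then have "act \<one>\<^bsub>G\<^esub> (w i) = act g (w j)" using T by (simp add: act_iff act_one)
    then show False using act_w_inject[OF ij(1,2) one_less g(1)] ij(3) by simp
  qed
  then have "T \<in> (\<lambda>A. A O S) ` thins"
    using T S_bij by (simp add: bij_betw_def)
  then obtain a where a: "a < r" "T = R a O S"
    using inv_into_less R_inv_into by (metis imageE)
  define b where "b = inv\<^bsub>G\<^esub> a"
  have b_less: "b < r" using a by (simp add: b_def inv_less)
  have b: "(act b (w i), w j) \<in> S"
    using T a by (auto simp: in_relcomp_iff act_inv b_def)
  \<comment> \<open>By symmetry \<open>S\<close> contains the reversed pair; acting on both of its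
    points by the inverse of \<open>b\<close> brings the second one back to
    \<open>w i\<close>.\<close>
  have "(act (inv\<^bsub>G\<^esub> b) (w j), w i) \<in> S"
  proof -
    have "act (inv\<^bsub>G\<^esub> b) (act b (w i)) = w i"
      using b_less by (simp add: act_one inv_less flip: act_mult)
    then have "adj_mat S $ act (inv\<^bsub>G\<^esub> b) (w j) $ w i = adj_mat S $ w j $ act b (w i)"
      using algebra_act[OF adj_mat_in[OF S_thick(1)] inv_less[OF b_less]] by metis
    moreover have "(w j, act b (w i)) \<in> S" using sym_S b by (rule symD)
    ultimately show ?thesis by (simp add: adj_mat_def)
  qed
  then show ?thesis
    using coeff_mat_eq_ga_elem[OF ij(1,2) b_less b]
      coeff_mat_eq_ga_elem[OF ij(2,1) inv_less[OF b_less]] b_less by blast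
qed

lemma roux_matrix_coeff_mat: "roux_matrix G n (coeff_mat (adj_mat S))"
proof -
  let ?B = "coeff_mat (adj_mat S)"
  have "?B \<in> ga_mat_carrier G n" by (simp add: ga_mat_carrier_def coeff_mat_def)
  moreover have "\<forall>M\<in>ga_mat_span (roux_basis G n ?B). \<forall>N\<in>ga_mat_span (roux_basis G n ?B).
      ga_mat_mult G n M N \<in> ga_mat_span (roux_basis G n ?B)"
    unfolding roux_basis_coeff_mat span_coeff_mat by (auto simp: coeff_mat_mult mult_in)
  ultimately show ?thesis
    unfolding roux_matrix_def
    using comm_group_G coeff_mat_diagonal coeff_mat_off_diagonal by auto
qed

lemma is_roux_scheme_of_coordinates: "is_roux_scheme UNIV Rs"
  unfolding is_roux_scheme_def
  using scheme roux_matrix_coeff_mat scheme_isomorphic_roux_relations[OF roux_basis_coeff_mat]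
  by blast

end

end

section \<open>Orbits of the thin radical\<close>

context comm_scheme
begin

text \<open>Since the thin relations form a group, their union is an equivalence relation, whose
  classes are the orbits. The classes are enumerated and a point is chosen in each.\<close>

lemma orbit_representatives:
  "\<exists>n (w :: nat \<Rightarrow> 'a). \<forall>x. \<exists>!i. i < n \<and> (\<exists>A\<in>thins. (x, w i) \<in> A)"
proof -
  have equiv: "equiv UNIV (\<Union>thins)"
  proof (rule equivI)
    show "\<Union>thins \<subseteq> UNIV \<times> UNIV" by simp
    show "refl (\<Union>thins)" using Id_thin by (auto intro!: refl_onI)
    show "sym (\<Union>thins)" using converse_thin by (auto intro!: symI)
    show "trans (\<Union>thins)" using thin_relcomp_thin by (auto intro!: transI)
  qed
  define Q where "Q = UNIV // \<Union>thins"
  obtain q where q: "bij_betw q {0..<card Q} Q"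
    using ex_bij_betw_nat_finite[of Q] by (auto simp: Q_def)
  define w where "w i = (SOME x. x \<in> q i)" for i
  have q_in: "q i \<in> Q" if "i < card Q" for i using q that by (auto simp: bij_betw_def)
  have w_in: "w i \<in> q i" if "i < card Q" for i
    unfolding w_def using in_quotient_imp_non_empty[OF equiv] q_in[OF that]
    by (metis Q_def ex_in_conv someI_ex)
  have orbit: "(\<exists>A\<in>thins. (x, w i) \<in> A) \<longleftrightarrow> q i = \<Union>thins `` {x}" if "i < card Q" for x i
  proof
    assume "\<exists>A\<in>thins. (x, w i) \<in> A"
    then have "w i \<in> \<Union>thins `` {x}" by blast
    moreover have "\<Union>thins `` {x} \<in> Q" unfolding Q_def by (rule quotientI) simp
    ultimately show "q i = \<Union>thins `` {x}"
      using quotient_disj[OF equiv] q_in[OF that] w_in[OF that] unfolding Q_def by blast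
  qed (use w_in[OF that] in auto)
  have "\<exists>!i. i < card Q \<and> q i = \<Union>thins `` {x}" for x
  proof -
    have "\<Union>thins `` {x} \<in> q ` {0..<card Q}"
      using q unfolding bij_betw_def Q_def by (simp add: quotientI)
    then obtain i where "i < card Q" "q i = \<Union>thins `` {x}" by auto
    then show ?thesis
      using inj_onD[OF bij_betw_imp_inj_on[OF q]] by (intro ex1I[of _ i]) auto
  qed
  then have "\<forall>x. \<exists>!i. i < card Q \<and> (\<exists>A\<in>thins. (x, w i) \<in> A)"
    using orbit by (simp cong: conj_cong)
  then show ?thesis by blast
qed

text \<open>The statement is free of coordinates; a numbering of the thin relations and orbit
  representatives are chosen here.\<close>

theorem is_roux_scheme_of_symmetric_thick:
  assumes "sym S" "bij_betw (\<lambda>A. A O S) thins (Rs - thins)"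
  shows "is_roux_scheme UNIV Rs"
proof -
  obtain n and w :: "nat \<Rightarrow> 'a" where "\<forall>x. \<exists>!i. i < n \<and> (\<exists>A\<in>thins. (x, w i) \<in> A)"
    using orbit_representatives by blast
  moreover obtain R where "bij_betw R {0..<card thins} thins"
    using ex_bij_betw_nat_finite[of thins] by auto
  ultimately interpret roux_coordinates Rs R "card thins" n w
    by unfold_locales (auto simp: lessThan_atLeast0)
  show ?thesis using assms by (rule is_roux_scheme_of_coordinates)
qed

end

section \<open>Products and symmetry read off from eigenvalues\<close>

lemma (in comm_scheme) sum_idempotents_mult:
  assumes e: "\<And>i. i \<in> I \<Longrightarrow> e i \<in> idempotents" "inj_on e I" "finite I"
  shows "(\<Sum>i\<in>I. mat_scale (a i) (e i)) ** (\<Sum>i\<in>I. mat_scale (b i) (e i)) =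
    (\<Sum>i\<in>I. mat_scale (a i * b i) (e i))"
proof (rule orthogonal_idempotents_mult)
  fix i j assume "i \<in> I" "j \<in> I" "i \<noteq> j"
  then show "e i ** e j = 0"
    using e by (intro idempotents_orthogonal) (auto simp: inj_on_eq_iff)
qed (use e idempotentD in auto)

text \<open>The adjoint fixes the Hermitian idempotents and conjugates the eigenvalues. Real
  eigenvalues thus give \<open>S\<close> and its converse the same adjacency matrix.\<close>

lemma (in comm_scheme) sym_of_real_eigenvalues:
  assumes e: "\<And>i. i \<in> I \<Longrightarrow> e i \<in> idempotents"
    and S: "adj_mat S = (\<Sum>i\<in>I. mat_scale (a i) (e i))"
    and real: "\<And>i. i \<in> I \<Longrightarrow> a i \<in> \<real>"
  shows "sym S"
proof -
  have "adj_mat (S\<inverse>) = (\<Sum>i\<in>I. mat_scale (cnj (a i)) (adjoint_mat (e i)))"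
    by (simp add: S adjoint_mat_sum adjoint_mat_scale flip: adjoint_mat_adj_mat)
  also have "\<dots> = adj_mat S"
    unfolding S by (intro sum.cong refl) (simp add: idempotent_hermitian e real Reals_cnj_iff[THEN iffD1])
  finally show ?thesis by (simp add: adj_mat_inject sym_conv_converse_eq)
qed

section \<open>Roux schemes from the first eigenmatrix\<close>

theorem theorem4p3:
  fixes Rs :: "('a::finite \<times> 'a) set set"
    and r :: nat
    and R :: "nat \<Rightarrow> ('a \<times> 'a) set"
    and E :: "nat \<Rightarrow> complex^'a^'a"
    and P T :: "nat \<Rightarrow> nat \<Rightarrow> complex"
    and character :: "nat \<Rightarrow> complex^'a^'a \<Rightarrow> complex"
    and d_plus d_minus :: "nat \<Rightarrow> complex"
  assumes scheme: "comm_association_scheme (UNIV :: 'a set) Rs"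
    and r: "order (thin_radical Rs) = r"
    and eigenmatrix: "first_eigenmatrix Rs (2 * r) R E P"
    and thin_first: "R ` {..<r} = {S \<in> Rs. thin UNIV S}"
    and characters: "bij_betw character {..<r} (characters (thin_radical Rs))"
    and char_table: "\<And>i j. i < r \<Longrightarrow> j < r \<Longrightarrow> T i j = character i (adj_mat (R j))"
    and upper_left: "\<And>i j. i < r \<Longrightarrow> j < r \<Longrightarrow> P i j = T i j"
    and upper_right: "\<And>i j. i < r \<Longrightarrow> j < r \<Longrightarrow> P i (r + j) = d_plus i * T i j"
    and lower_left: "\<And>i j. i < r \<Longrightarrow> j < r \<Longrightarrow> P (r + i) j = T i j"
    and lower_right: "\<And>i j. i < r \<Longrightarrow> j < r \<Longrightarrow> P (r + i) (r + j) = d_minus i * T i j"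
    and real_thick_column: "\<exists>j<2 * r. \<not> thin UNIV (R j) \<and> (\<forall>i<2 * r. P i j \<in> \<real>)"
  shows "is_roux_scheme (UNIV :: 'a set) Rs"
proof -
  interpret comm_scheme Rs by unfold_locales (rule scheme)
  have R: "bij_betw R {..<2 * r} Rs" and E: "bij_betw E {..<2 * r} idempotents"
    and P: "\<And>j. j < 2 * r \<Longrightarrow> adj_mat (R j) = (\<Sum>i<2 * r. mat_scale (P i j) (E i))"
    using eigenmatrix by (auto simp: first_eigenmatrix_def)
  have thins: "R ` {..<r} = thins" using thin_first by (simp add: thins_def)
  have R_inject: "R i = R j \<longleftrightarrow> i = j" if "i < 2 * r" "j < 2 * r" for i j
    using R that by (auto simp: bij_betw_def inj_on_eq_iff)
  have R_thin: "R j \<in> thins" if "j < r" for j using thins that by blast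
  have E_in: "E i \<in> idempotents" if "i \<in> {..<2 * r}" for i using E that by (rule bij_betw_apply)
  \<comment> \<open>The identity relation may stand anywhere among the first \<open>r\<close>
    columns; \<open>e\<close> is its position.\<close>
  obtain e where e: "e < r" "R e = Id" using Id_thin unfolding thins[symmetric] by auto
  have T_e: "T i e = 1" if "i < r" for i
  proof -
    have one: "adj_mat Id = (mat 1 :: complex^'a^'a)"
      by (simp add: adj_mat_def mat_def vec_eq_iff)
    have "character i \<in> hom (thin_radical Rs) complex_units"
      using characters that by (auto simp: bij_betw_def characters_def)
    moreover have "mat 1 \<in> carrier (thin_radical Rs)"
      using Id_thin by (auto simp: thin_radical_def thins_def simp flip: one)
    \<comment> \<open>The value at the identity is a nonzero number equal to its own square, hence
      1.\<close>
    ultimately have "character i (mat 1) \<noteq> 0"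
        "character i (mat 1 ** mat 1) = character i (mat 1) * character i (mat 1)"
      using hom_in_carrier[of "character i" "thin_radical Rs" complex_units "mat 1"]
        hom_mult[of "character i" "thin_radical Rs" complex_units "mat 1" "mat 1"]
      by (simp_all add: complex_units_def thin_radical_def)
    then show ?thesis using that e one by (simp add: char_table)
  qed
  have thick_index: "\<exists>k<r. j = r + k" if "j < 2 * r" "\<not> j < r" for j
    using that by (intro exI[of _ "j - r"]) simp
  \<comment> \<open>As column \<open>e\<close> of \<open>T\<close> is constantly 1, column
    \<open>r + e\<close> of \<open>P\<close> consists of the diagonal factors \<open>d_plus\<close>
    and \<open>d_minus\<close> alone.\<close>
  define S0 where "S0 = R (r + e)"
  have thick: "R (r + j) = R j O S0" if j: "j < r" for j
  proof -
    \<comment> \<open>In both halves the thick column is the thin column times the diagonal factor,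
      so the eigenvalues of \<open>R (r + j)\<close> are products of those of \<open>R j\<close> and
      \<open>S0\<close>.\<close>
    have column: "P i (r + j) = P i j * P i (r + e)" if i: "i < 2 * r" for i
    proof (cases "i < r")
      case True
      then show ?thesis using j e by (simp add: upper_left upper_right T_e)
    next
      case False
      then obtain k where "k < r" "i = r + k" using thick_index i by blast
      then show ?thesis using j e by (simp add: lower_left lower_right T_e)
    qed
    have "adj_mat (R (r + j)) = (\<Sum>i<2 * r. mat_scale (P i (r + j)) (E i))"
      using j by (intro P) simp
    also have "\<dots> = (\<Sum>i<2 * r. mat_scale (P i j * P i (r + e)) (E i))"
      by (intro sum.cong refl) (simp add: column)
    also have "\<dots> =
        (\<Sum>i<2 * r. mat_scale (P i j) (E i)) ** (\<Sum>i<2 * r. mat_scale (P i (r + e)) (E i))"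
      by (rule sum_idempotents_mult[symmetric]) (simp_all add: E_in bij_betw_imp_inj_on[OF E])
    also have "\<dots> = adj_mat (R j) ** adj_mat S0"
      using P[of j] P[of "r + e"] j e(1) by (simp add: S0_def)
    also have "\<dots> = adj_mat (R j O S0)" using adj_mat_relcomp[OF R_thin[OF j]] by simp
    finally show ?thesis by (simp add: adj_mat_inject)
  qed
  have thin_iff: "R j \<in> thins \<longleftrightarrow> j < r" if "j < 2 * r" for j
  proof
    assume "R j \<in> thins"
    then obtain i where "i < r" "R j = R i" unfolding thins[symmetric] by auto
    then show "j < r" using R_inject[of j i] that by simp
  qed (rule R_thin)
  obtain j0 where j0: "j0 < 2 * r" "\<not> thin UNIV (R j0)" "\<And>i. i < 2 * r \<Longrightarrow> P i j0 \<in> \<real>"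
    using real_thick_column by blast
  \<comment> \<open>The real column need not be column \<open>r + e\<close>, so the symmetric
    relation \<open>S\<close> may differ from \<open>S0\<close>. It is a translate of
    \<open>S0\<close>, and the translation property is carried over to it below.\<close>
  define S where "S = R j0"
  have "sym S"
    using sym_of_real_eigenvalues[of "{..<2 * r}" E S "\<lambda>i. P i j0"] E_in P j0 by (simp add: S_def)
  have "\<not> j0 < r" using j0 thin_iff by (auto simp: thins_def)
  then obtain k where k: "k < r" "j0 = r + k" using thick_index j0(1) by blast
  have S: "S = R k O S0" using thick k by (simp add: S_def)
  have S_in: "S \<in> Rs" using R j0 by (auto simp: S_def bij_betw_def)
  have S0: "S0 = (R k)\<inverse> O S"
    using thin_relcomp_converse(2)[OF R_thin[OF k(1)]] by (simp add: S flip: O_assoc)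
  have S_notin: "S \<notin> thins" using j0 by (simp add: S_def thins_def)
  \<comment> \<open>Translates of \<open>S0\<close> by distinct thin relations occupy distinct
    positions in the second half of the enumeration \<open>R\<close>.\<close>
  have inj_S0: "A = B" if AB: "A \<in> thins" "B \<in> thins" "A O S0 = B O S0" for A B
  proof -
    obtain a b where ab: "a < r" "A = R a" "b < r" "B = R b"
      using AB(1,2) unfolding thins[symmetric] by auto
    then have "R (r + a) = R (r + b)" using thick AB(3) by simp
    then show ?thesis using ab R_inject[of "r + a" "r + b"] by simp
  qed
  have "bij_betw (\<lambda>A. A O S) thins (Rs - thins)"
  proof (intro bij_betw_imageI inj_onI)
    fix A B assume AB: "A \<in> thins" "B \<in> thins" "A O S = B O S"
    have "A O R k = B O R k"
    proof (rule inj_S0)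
      show "(A O R k) O S0 = (B O R k) O S0" using AB(3) by (simp only: S O_assoc)
    qed (use AB k R_thin thin_relcomp_thin in blast)+
    then have "(A O R k) O (R k)\<inverse> = (B O R k) O (R k)\<inverse>" by simp
    then show "A = B" using thin_relcomp_converse(1)[OF R_thin[OF k(1)]] by (simp add: O_assoc)
  next
    show "(\<lambda>A. A O S) ` thins = Rs - thins"
    proof (intro subset_antisym subsetI)
      fix U assume "U \<in> (\<lambda>A. A O S) ` thins"
      then obtain A where A: "A \<in> thins" "U = A O S" by blast
      \<comment> \<open>If \<open>U\<close> were thin, this would present \<open>S\<close> as a
        product of two thin relations.\<close>
      have "S = A\<inverse> O U" using thin_relcomp_converse(2)[OF A(1)] by (simp add: A(2) flip: O_assoc)
      then have "U \<notin> thins" using S_notin thin_relcomp_thin converse_thin A(1) by metis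
      then show "U \<in> Rs - thins" using A thin_relcomp_in S_in by simp
    next
      fix U assume "U \<in> Rs - thins"
      then obtain j where "j < 2 * r" "U = R j" "\<not> j < r" using R thin_iff by (auto simp: bij_betw_def)
      then obtain l where l: "l < r" "U = R (r + l)" using thick_index by blast
      \<comment> \<open>Solving \<open>S = R k O S0\<close> for \<open>S0\<close> turns the
        translate of \<open>S0\<close> by \<open>R l\<close> into a translate of
        \<open>S\<close>.\<close>
      then have "U = (R l O (R k)\<inverse>) O S" using thick S0 by (simp add: O_assoc)
      moreover have "R l O (R k)\<inverse> \<in> thins"
        using thin_relcomp_thin converse_thin R_thin l k by blast
      ultimately show "U \<in> (\<lambda>A. A O S) ` thins" by blast
    qed
  qed
  with \<open>sym S\<close> show ?thesis by (rule is_roux_scheme_of_symmetric_thick)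
qed

end
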